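(* Let $(\mathbb{N}_0,b,m)$ be a birth-death chain such that, for a constant $b>0$, $b(r+1,r)=b$ for all $r\ge 0$. Let $W:\mathbb{N}_0\to\mathbb{R}$ be a potential with $W(r)m(r)=r^{\gamma}$ for all $r$, for some $\gamma\in\mathbb{N}=\{1,2,\dots\}$. If $v:\mathbb{N}_0\to\mathbb{R}$ is a function such that $(\Delta+W)v=0$ on $\mathbb{N}_0$, then, writing $v_r=v(r)$, the generating function $A(z)=\sum_{r=1}^{\infty}v_rz^r$ is a solution to the $\gamma$th order differential equation $$A(z)=\frac{v_0z}{1-z}+\frac{(v_1-v_0)z}{(1-z)^2}+\left(\frac{z/b}{(z-1)^2}\right)\sum_{k=0}^{\gamma}{\gamma\brace k}\left(\left(\frac{d}{dz}\right)^kA(z)\right)z^k,$$ where ${\gamma\brace k}=\sum_{i=0}^{k}\frac{(-1)^{k-i}i^{\gamma}}{(k-i)!\,i!}$ are the Stirling numbers of the second kind.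
   Context: $\mathbb{N}_0=\{0,1,2,\dots\}$. A birth-death chain $(\mathbb{N}_0,b,m)$ consists of a symmetric edge-weight $b:\mathbb{N}_0\times\mathbb{N}_0\to[0,\infty)$ with $b(x,y)>0$ if and only if $|x-y|=1$, and a measure $m:\mathbb{N}_0\to(0,\infty)$. The formal Laplacian acts on all functions $f:\mathbb{N}_0\to\mathbb{R}$ by $$\Delta f(x)=\frac{1}{m(x)}\sum_{y\in\mathbb{N}_0}b(x,y)(f(x)-f(y)),$$ and $W$ acts by multiplication, $(Wf)(x)=W(x)f(x)$. The same letter $b$ denotes both the edge-weight function and its constant value on edges. Generating functions are understood as formal power series in $z$ over $\mathbb{R}$, with $d/dz$ the formal derivative, and rational functions of $z$ are identified with their expansions at $z=0$. *)

theory Defs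
  imports Complex_Main "HOL-Computational_Algebra.Formal_Power_Series"
    "HOL-Combinatorics.Stirling"
begin

definition birth_death_chain :: "(nat \<Rightarrow> nat \<Rightarrow> real) \<Rightarrow> (nat \<Rightarrow> real) \<Rightarrow> bool" where
  "birth_death_chain b m \<longleftrightarrow>
     (\<forall>x y. b x y = b y x) \<and>
     (\<forall>x y. b x y \<ge> 0) \<and>
     (\<forall>x y. b x y > 0 \<longleftrightarrow> \<bar>int x - int y\<bar> = 1) \<and>
     (\<forall>x. m x > 0)"

(* On a birth-death chain at most two summands are nonzero, so the series converges for every f. *)
definition laplacian ::
  "(nat \<Rightarrow> nat \<Rightarrow> real) \<Rightarrow> (nat \<Rightarrow> real) \<Rightarrow> (nat \<Rightarrow> real) \<Rightarrow> nat \<Rightarrow> real" where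
  "laplacian b m f x = 1 / m x * (\<Sum>y. b x y * (f x - f y))"

(* The sum starts at r = 1: the constant coefficient is 0, not v 0. *)
definition gen_fun :: "(nat \<Rightarrow> real) \<Rightarrow> real fps" where
  "gen_fun v = Abs_fps (\<lambda>r. if r = 0 then 0 else v r)"

end

theory Submission
  imports Defs
begin

text \<open>
  The Euler operator \<open>\<theta> = z d/dz\<close> multiplies the coefficient of \<open>z\<^sup>n\<close> by \<open>n\<close>.  Pushing all powers of
  \<open>z\<close> to one side of the derivatives turns \<open>\<theta>\<^sup>\<gamma>\<close> into the sum of \<open>S(\<gamma>,k) z\<^sup>k (d/dz)\<^sup>k\<close>, because the
  product rule produces exactly the recurrence of the Stirling numbers of the second kind
  (\<open>euler_operator_power\<close>).  So the sum in the differential equation is the power series with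
  coefficients \<open>n\<^sup>\<gamma> v\<^sub>n\<close>.

  On the other side, multiplying the equation \<open>(\<Delta> + W) v = 0\<close> at \<open>x \<ge> 1\<close> by \<open>m x\<close> and using that all
  edge weights equal \<open>c\<close> leaves the three-term recurrence
  \<open>c (v\<^sub>x\<^sub>+\<^sub>1 - 2 v\<^sub>x + v\<^sub>x\<^sub>-\<^sub>1) = x\<^sup>\<gamma> v\<^sub>x\<close>.  Second differences of coefficients correspond to
  multiplication by \<open>(1 - z)\<^sup>2\<close>, so comparing coefficients gives
  \<open>(1 - z)\<^sup>2 A = v\<^sub>0 z (1 - z) + (v\<^sub>1 - v\<^sub>0) z + (z/c) \<theta>\<^sup>\<gamma> A\<close>.  The first two terms add up to
  \<open>v\<^sub>1 z - v\<^sub>0 z\<^sup>2\<close>: the initial value \<open>v\<^sub>1\<close>, which the recurrence does not reach, and a correction in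
  degree two, where the recurrence refers to \<open>v\<^sub>0\<close> but the constant coefficient of \<open>A\<close> is \<open>0\<close>.
  Dividing by the unit \<open>(1 - z)\<^sup>2\<close> yields the differential equation.  The closed form of \<open>S(\<gamma>,k)\<close> is
  independent of the chain and follows from the same Stirling recurrence
  (\<open>Stirling_explicit_formula\<close>).
\<close>

text \<open>
  Both sides satisfy \<open>S(n+1,k+1) = (k+1) S(n,k+1) + S(n,k)\<close>: on the right, the summand for \<open>i\<close>
  acquires the factor \<open>(k+1) - (k+1-i) = i\<close>, which raises the power of \<open>i\<close> by one.
  For \<open>n = 0\<close> the right-hand side is \<open>(1 - 1)\<^sup>k / k!\<close>.
\<close>
lemma Stirling_explicit_formula:
  "real (Stirling n k) = (\<Sum>i=0..k. (-1) ^ (k - i) * real i ^ n / (fact (k - i) * fact i))"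
proof (induction n arbitrary: k)
  case 0
  show ?case
  proof (cases k)
    case (Suc l)
    have "(\<Sum>i=0..k. (-1) ^ (k - i) * real i ^ 0 / (fact (k - i) * fact i))
        = (\<Sum>i\<le>k. of_nat (k choose i) * 1 ^ i * (-1) ^ (k - i)) / (fact k :: real)"
      unfolding sum_divide_distrib atLeast0AtMost
      by (rule sum.cong) (simp_all add: binomial_fact field_simps)
    also have "\<dots> = (1 + (-1)) ^ k / (fact k :: real)"
      by (simp only: binomial_ring)
    also have "\<dots> = 0"
      using Suc by simp
    finally show ?thesis
      using Suc by simp
  qed simp
next
  case (Suc n)
  show ?case
  proof (cases k)
    case (Suc l)
    define s where "s = (\<lambda>n k i. (-1) ^ (k - i) * real i ^ n / (fact (k - i) * fact i :: real))"
    have step: "real (Suc l) * s n (Suc l) i + s n l i = s (Suc n) (Suc l) i" if "i \<le> l" for i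
    proof -
      obtain d where d: "l = i + d"
        using \<open>i \<le> l\<close> le_Suc_ex by blast
      show ?thesis
        by (simp add: s_def d Suc_diff_le field_simps del: of_nat_Suc)
           (simp add: algebra_simps)
    qed
    have "real (Stirling (Suc n) (Suc l)) = real (Suc l) * sum (s n (Suc l)) {0..Suc l} + sum (s n l) {0..l}"
      unfolding Stirling.simps of_nat_add of_nat_mult Suc.IH s_def by (rule refl)
    also have "\<dots> = (\<Sum>i=0..l. real (Suc l) * s n (Suc l) i + s n l i) + real (Suc l) * s n (Suc l) (Suc l)"
      by (simp add: sum.distrib sum_distrib_left distrib_left)
    also have "\<dots> = (\<Sum>i=0..l. s (Suc n) (Suc l) i) + s (Suc n) (Suc l) (Suc l)"
      using step by (intro arg_cong2[of _ _ _ _ "(+)"] sum.cong) (simp_all add: s_def)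
    finally show ?thesis
      by (simp add: \<open>k = Suc l\<close> s_def)
  qed simp
qed

text \<open>
  Applying \<open>z d/dz\<close> to \<open>z\<^sup>k f\<^sup>(\<^sup>k\<^sup>)\<close> gives \<open>k z\<^sup>k f\<^sup>(\<^sup>k\<^sup>) + z\<^sup>k\<^sup>+\<^sup>1 f\<^sup>(\<^sup>k\<^sup>+\<^sup>1\<^sup>)\<close>, so the coefficients of the normally
  ordered form obey the recurrence of the Stirling numbers.
\<close>
lemma euler_operator_power:
  fixes f :: "'a::comm_ring_1 fps"
  shows "(fps_XD ^^ n) f
    = (\<Sum>k=0..n. of_nat (Stirling n k) * (fps_deriv ^^ k) f * fps_X ^ k)"
proof (induction n)
  case (Suc n)
  define u where "u = (\<lambda>k. (fps_deriv ^^ k) f * fps_X ^ k)"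
  have theta_power: "fps_X * fps_deriv (fps_X ^ k) = (of_nat k * fps_X ^ k :: 'a fps)" for k
    by (rule fps_ext) (simp add: fps_of_nat[symmetric])
  have "fps_XD (u k) = u (Suc k) + (fps_deriv ^^ k) f * (fps_X * fps_deriv (fps_X ^ k))" for k
    by (simp add: u_def fps_XD_def algebra_simps)
  then have theta_u: "fps_XD (u k) = of_nat k * u k + u (Suc k)" for k
    by (simp add: theta_power u_def algebra_simps)
  have "(fps_XD ^^ Suc n) f
      = fps_XD (\<Sum>k=0..n. of_nat (Stirling n k) * u k)"
    by (simp add: Suc u_def mult.assoc)
  also have "\<dots> = (\<Sum>k=0..n. of_nat (Stirling n k) * fps_XD (u k))"
    by (simp add: fps_XD_def fps_deriv_sum sum_distrib_left algebra_simps)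
  also have "\<dots> = (\<Sum>k=0..n. of_nat (k * Stirling n k) * u k) + (\<Sum>k=0..n. of_nat (Stirling n k) * u (Suc k))"
    by (simp add: theta_u algebra_simps sum.distrib)
  \<comment> \<open>After the shift the sum runs to \<open>k = n + 1\<close>; that term vanishes because \<open>S(n,n+1) = 0\<close>.\<close>
  also have "(\<Sum>k=0..n. of_nat (k * Stirling n k) * u k)
      = (\<Sum>k=0..n. of_nat (Suc k * Stirling n (Suc k)) * u (Suc k))"
    using sum.atLeast0_atMost_Suc_shift[of "\<lambda>k. of_nat (k * Stirling n k) * u k" n]
    by (simp add: sum.atLeast0_atMost_Suc del: of_nat_mult mult_Suc)
  also have "\<dots> + (\<Sum>k=0..n. of_nat (Stirling n k) * u (Suc k))
      = (\<Sum>k=0..n. of_nat (Stirling (Suc n) (Suc k)) * u (Suc k))"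
    by (simp add: sum.distrib algebra_simps)
  also have "\<dots> = (\<Sum>k=0..Suc n. of_nat (Stirling (Suc n) k) * u k)"
    by (subst sum.atLeast0_atMost_Suc_shift) simp
  finally show ?case
    by (simp add: u_def mult.assoc)
qed simp

text \<open>Only the two neighbours of a positive vertex contribute to its series.\<close>
lemma laplacian_birth_death_chain_Suc:
  assumes "birth_death_chain b m"
  shows "laplacian b m f (Suc x)
    = (b (Suc (Suc x)) (Suc x) * (f (Suc x) - f (Suc (Suc x))) + b (Suc x) x * (f (Suc x) - f x)) / m (Suc x)"
proof -
  have sym: "b x y = b y x" for x y
    using assms by (simp add: birth_death_chain_def)
  have zero: "b x y = 0" if "\<bar>int x - int y\<bar> \<noteq> 1" for x y
    using assms that unfolding birth_death_chain_def by (metis order_le_less)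
  have "(\<Sum>y. b (Suc x) y * (f (Suc x) - f y)) = (\<Sum>y\<in>{x, Suc (Suc x)}. b (Suc x) y * (f (Suc x) - f y))"
    by (rule suminf_finite) (auto intro!: zero)
  then show ?thesis
    by (simp add: laplacian_def sym[of "Suc x" "Suc (Suc x)"] add.commute)
qed

theorem corollary5p7:
  fixes b :: "nat \<Rightarrow> nat \<Rightarrow> real" and m W v :: "nat \<Rightarrow> real"
    and c :: real and \<gamma> :: nat and A :: "real fps"
  assumes "birth_death_chain b m"
    and "c > 0"
    and "\<And>r. b (r + 1) r = c"
    and "\<gamma> \<ge> 1"
    and "\<And>r. W r * m r = real r ^ \<gamma>"
    and "\<And>x. laplacian b m v x + W x * v x = 0"
    and "A = gen_fun v"
  shows "A = fps_const (v 0) * fps_X / (1 - fps_X)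
           + fps_const (v 1 - v 0) * fps_X / (1 - fps_X)^2
           + (fps_X / fps_const c) / (fps_X - 1)^2
             * (\<Sum>k=0..\<gamma>. of_nat (Stirling \<gamma> k) * (fps_deriv ^^ k) A * fps_X ^ k)
       \<and> (\<forall>k\<le>\<gamma>. real (Stirling \<gamma> k)
             = (\<Sum>i=0..k. (-1) ^ (k - i) * real i ^ \<gamma> / (fact (k - i) * fact i)))"
proof
  define B where "B = (fps_XD ^^ \<gamma>) A"
  have A_nth: "fps_nth A n = (if n = 0 then 0 else v n)" for n
    by (simp add: assms(7) gen_fun_def)
  \<comment> \<open>At \<open>n = 0\<close> the coefficient of \<open>A\<close> is not \<open>v 0\<close>, but the factor \<open>0 ^ \<gamma>\<close> is \<open>0\<close>.\<close>
  have B_nth: "fps_nth B n = real n ^ \<gamma> * v n" for n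
    using \<open>\<gamma> \<ge> 1\<close> by (simp add: B_def fps_mult_fps_XD_shift A_nth)
  have recurrence: "v (Suc (Suc x)) - 2 * v (Suc x) + v x = real (Suc x) ^ \<gamma> * v (Suc x) / c" for x
  proof -
    have "m (Suc x) > 0"
      using assms(1) by (simp add: birth_death_chain_def)
    then have "c * (v (Suc x) - v (Suc (Suc x))) + c * (v (Suc x) - v x) + W (Suc x) * m (Suc x) * v (Suc x) = 0"
      using assms(6)[of "Suc x"] assms(3)[of x] assms(3)[of "Suc x"]
      unfolding laplacian_birth_death_chain_Suc[OF assms(1)]
      by (simp add: field_simps)
    then show ?thesis
      using \<open>c > 0\<close> unfolding assms(5) by (simp add: field_simps)
  qed
  have cleared: "A * (1 - fps_X)^2
      = fps_const (v 0) * fps_X * (1 - fps_X) + fps_const (v 1 - v 0) * fps_X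
        + fps_const (1 / c) * fps_X * B"
  proof (rule fps_ext)
    fix n
    have square: "A * (1 - fps_X)^2 = A - fps_const 2 * (fps_X * A) + fps_X * (fps_X * A)"
      by (simp add: numeral_fps_const[symmetric] power2_eq_square algebra_simps)
    consider "n = 0" | "n = 1" | x where "n = Suc (Suc x)"
      by (metis One_nat_def not0_implies_Suc)
    then show "fps_nth (A * (1 - fps_X)^2) n = fps_nth (fps_const (v 0) * fps_X * (1 - fps_X)
        + fps_const (v 1 - v 0) * fps_X + fps_const (1 / c) * fps_X * B) n"
    proof cases
      case 3
      then show ?thesis
        using recurrence[of x]
        by (cases x) (simp_all add: square mult.assoc A_nth B_nth)
    qed (use \<open>\<gamma> \<ge> 1\<close> in \<open>simp_all add: square mult.assoc A_nth B_nth\<close>)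
  qed
  have unit: "(1 - fps_X) * inverse (1 - fps_X :: real fps) = 1"
    by (simp add: inverse_mult_eq_1')
  have "A = A * (1 - fps_X)^2 * inverse (1 - fps_X)^2"
    by (simp add: mult.assoc power_mult_distrib[symmetric] unit)
  also have "\<dots> = fps_const (v 0) * fps_X * inverse (1 - fps_X) * ((1 - fps_X) * inverse (1 - fps_X))
      + fps_const (v 1 - v 0) * fps_X * inverse (1 - fps_X)^2
      + fps_const (1 / c) * fps_X * inverse (1 - fps_X)^2 * B"
    unfolding cleared by (simp add: algebra_simps power2_eq_square)
  also have "\<dots> = fps_const (v 0) * fps_X / (1 - fps_X)
      + fps_const (v 1 - v 0) * fps_X / (1 - fps_X)^2
      + (fps_X / fps_const c) / (fps_X - 1)^2 * B"
    unfolding unit power2_commute[of fps_X 1]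
    using \<open>c > 0\<close>
    by (simp add: fps_divide_unit fps_inverse_power fps_const_inverse divide_inverse mult.commute mult.left_commute)
  finally show "A = fps_const (v 0) * fps_X / (1 - fps_X)
           + fps_const (v 1 - v 0) * fps_X / (1 - fps_X)^2
           + (fps_X / fps_const c) / (fps_X - 1)^2
             * (\<Sum>k=0..\<gamma>. of_nat (Stirling \<gamma> k) * (fps_deriv ^^ k) A * fps_X ^ k)"
    unfolding B_def euler_operator_power .
  show "\<forall>k\<le>\<gamma>. real (Stirling \<gamma> k)
      = (\<Sum>i=0..k. (-1) ^ (k - i) * real i ^ \<gamma> / (fact (k - i) * fact i))"
    using Stirling_explicit_formula by blast
qed

end
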